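(* Let $f=h+\overline{g}$ be a harmonic entire mapping of order $\rho$, $0<\rho<\infty$, where $h(z)=\sum_{n=0}^{\infty}a_nz^n$ and $g(z)=\sum_{n=1}^{\infty}b_nz^n$. If $f$ is of finite type, then the type of $f$ equals $$\tau_0=\frac{1}{e\rho}\limsup_{n\to\infty}n\left(|a_n|+|b_n|\right)^{\rho/n}.$$
   Context: A harmonic entire mapping is a complex-valued harmonic function $f$ on $\mathbb{C}$; it has a canonical decomposition $f=h+\overline{g}$ with $h,g$ entire and $g(0)=0$. For $r>0$ let $M(r,f)=\max_{0\le\theta<2\pi}|f(re^{i\theta})|$. The order of $f$ is $\rho=\limsup_{r\to\infty}\frac{\log\log M(r,f)}{\log r}\in[0,\infty]$ (constants have order $0$). If $0<\rho<\infty$, the type of $f$ is $\tau=\limsup_{r\to\infty}\frac{\log M(r,f)}{r^{\rho}}\in[0,\infty]$; $f$ is of finite type if $\tau<\infty$. *)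

theory Defs
  imports "HOL-Complex_Analysis.Complex_Analysis"
begin

text \<open>
  The real directional derivative of \<open>f\<close> at \<open>z\<close>; with \<open>z = x + \<i> y\<close>, the directions \<open>1\<close> and
  \<open>\<i>\<close> give \<open>\<partial>f/\<partial>x\<close> and \<open>\<partial>f/\<partial>y\<close>.
\<close>

definition partial_deriv :: "complex \<Rightarrow> (complex \<Rightarrow> complex) \<Rightarrow> complex \<Rightarrow> complex" where
  "partial_deriv u f z = vector_derivative (\<lambda>t::real. f (z + of_real t * u)) (at 0)"

definition real_C1 :: "(complex \<Rightarrow> complex) \<Rightarrow> bool" where
  "real_C1 f \<longleftrightarrow> (\<forall>u\<in>{1, \<i>}.
     (\<forall>z. (\<lambda>t::real. f (z + of_real t * u)) differentiable (at 0)) \<and>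
     continuous_on UNIV (partial_deriv u f))"

text \<open>Twice continuously differentiable in the real sense, with vanishing Laplacian.\<close>

definition harmonic_entire :: "(complex \<Rightarrow> complex) \<Rightarrow> bool" where
  "harmonic_entire f \<longleftrightarrow>
     real_C1 f \<and> real_C1 (partial_deriv 1 f) \<and> real_C1 (partial_deriv \<i> f) \<and>
     (\<forall>z. partial_deriv 1 (partial_deriv 1 f) z + partial_deriv \<i> (partial_deriv \<i> f) z = 0)"

text \<open>For continuous \<open>f\<close> the supremum is attained, so it is the maximum of \<open>|f|\<close> on \<open>|z| = r\<close>.\<close>

definition max_modulus :: "real \<Rightarrow> (complex \<Rightarrow> complex) \<Rightarrow> real" where
  "max_modulus r f = (SUP \<theta>\<in>{0..<2 * pi}. norm (f (of_real r * cis \<theta>)))"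

text \<open>
  A nonconstant harmonic entire mapping is unbounded, so the iterated logarithm is eventually
  that of a number greater than 1; only constants need a separate convention.
\<close>

definition growth_order :: "(complex \<Rightarrow> complex) \<Rightarrow> ereal" where
  "growth_order f =
     (if f constant_on UNIV then 0
      else Limsup at_top (\<lambda>r::real. ereal (ln (ln (max_modulus r f)) / ln r)))"

text \<open>Meaningful only if \<open>0 < growth_order f < \<infinity>\<close>.\<close>

definition growth_type :: "(complex \<Rightarrow> complex) \<Rightarrow> ereal" where
  "growth_type f =
     Limsup at_top (\<lambda>r::real. ereal (ln (max_modulus r f) / r powr real_of_ereal (growth_order f)))"

lemma partial_deriv_holomorphic_plus_cnj:
  assumes "h holomorphic_on UNIV" "g holomorphic_on UNIV"
  shows "((\<lambda>t::real. h (z + of_real t * u) + cnj (g (z + of_real t * u)))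
           has_vector_derivative (u * deriv h z + cnj (u * deriv g z))) (at 0)"
proof -
  have *: "((\<lambda>t::real. k (z + of_real t * u)) has_vector_derivative (u * deriv k z)) (at 0)"
    if "k holomorphic_on UNIV" for k
  proof -
    have "(k has_field_derivative deriv k z) (at (z + of_real 0 * u))"
      using that by (simp add: holomorphic_derivI)
    moreover have "((\<lambda>t::real. z + of_real t * u) has_vector_derivative u) (at 0)"
      by (auto intro!: derivative_eq_intros)
    ultimately show ?thesis
      using field_vector_diff_chain_at[of "\<lambda>t::real. z + of_real t * u" u 0 k "deriv k z"]
      by (simp add: o_def)
  qed
  show ?thesis
    by (intro has_vector_derivative_add has_vector_derivative_cnj * assms)
qed

lemma real_C1_holomorphic_plus_cnj:
  assumes "h holomorphic_on UNIV" "g holomorphic_on UNIV"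
  shows "real_C1 (\<lambda>z. h z + cnj (g z))"
    and "partial_deriv u (\<lambda>z. h z + cnj (g z)) = (\<lambda>z. u * deriv h z + cnj (u * deriv g z))"
proof -
  show pd: "partial_deriv u (\<lambda>z. h z + cnj (g z)) = (\<lambda>z. u * deriv h z + cnj (u * deriv g z))"
    for u
    unfolding partial_deriv_def
    using vector_derivative_at[OF partial_deriv_holomorphic_plus_cnj[OF assms]] by blast
  have "continuous_on UNIV (deriv h)" "continuous_on UNIV (deriv g)"
    using assms by (auto intro!: holomorphic_on_imp_continuous_on holomorphic_deriv)
  then have "continuous_on UNIV (\<lambda>z. u * deriv h z + cnj (u * deriv g z))" for u
    by (intro continuous_intros)
  moreover have "(\<lambda>t::real. h (z + of_real t * u) + cnj (g (z + of_real t * u))) differentiable (at 0)"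
    for z u
    using partial_deriv_holomorphic_plus_cnj[OF assms] by (rule differentiableI_vector)
  ultimately show "real_C1 (\<lambda>z. h z + cnj (g z))"
    unfolding real_C1_def pd by blast
qed

lemma harmonic_entire_holomorphic_plus_cnj:
  assumes "h holomorphic_on UNIV" "g holomorphic_on UNIV"
  shows "harmonic_entire (\<lambda>z. h z + cnj (g z))"
proof -
  have hol: "(\<lambda>z. u * deriv k z) holomorphic_on UNIV" if "k holomorphic_on UNIV" for k u
    using that by (intro holomorphic_intros holomorphic_deriv) auto
  have dd: "deriv (\<lambda>z. u * deriv k z) = (\<lambda>z. u * deriv (deriv k) z)"
    if "k holomorphic_on UNIV" for k u
  proof
    fix z
    have "deriv k field_differentiable at z"
      using that holomorphic_deriv holomorphic_on_imp_differentiable_at by blast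
    then show "deriv (\<lambda>z. u * deriv k z) z = u * deriv (deriv k) z" by simp
  qed
  note C1 = real_C1_holomorphic_plus_cnj
  show ?thesis
    unfolding harmonic_entire_def C1(2)[OF assms]
      C1(2)[OF hol[OF assms(1)] hol[OF assms(2)]]
  proof (intro conjI allI)
    show "1 * deriv (\<lambda>z. 1 * deriv h z) z + cnj (1 * deriv (\<lambda>z. 1 * deriv g z) z) +
      (\<i> * deriv (\<lambda>z. \<i> * deriv h z) z + cnj (\<i> * deriv (\<lambda>z. \<i> * deriv g z) z)) = 0" for z
      unfolding dd[OF assms(1)] dd[OF assms(2)] by (simp flip: mult.assoc)
  qed (rule C1(1) hol assms)+
qed

end

theory Submission
  imports Defs "HOL-Real_Asymp.Real_Asymp"
begin

text \<open>
  Averaging \<open>f\<close> against \<open>e\<^sup>-\<^sup>i\<^sup>n\<^sup>\<theta>\<close> over the circle \<open>|z| = r\<close> kills the antiholomorphic part and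
  isolates \<open>a\<^sub>n r\<^sup>n\<close>; the same for \<open>cnj f\<close> isolates \<open>b\<^sub>n r\<^sup>n\<close>. Hence
  \<open>(|a\<^sub>n| + |b\<^sub>n|) r\<^sup>n \<le> 2 M(r)\<close>, and taking \<open>r\<^sup>\<rho> = n / (\<rho> T)\<close> for \<open>T\<close> above the type
  bounds the limsup (the factor 2 disappears in the power \<open>\<rho>/n\<close>). Conversely
  \<open>M(r) \<le> \<Sum> (|a\<^sub>n| + |b\<^sub>n|) r\<^sup>n\<close>, and \<open>(L/n)\<^sup>n\<^sup>/\<^sup>\<rho> r\<^sup>n \<le> exp (L r\<^sup>\<rho> / (e \<rho>))\<close> for every \<open>n\<close>, so the
  series is at most a constant times this exponential as soon as \<open>L\<close> exceeds the limsup.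
\<close>

section \<open>Maximum modulus and coefficients as circle means\<close>

lemma norm_le_max_modulus:
  assumes "continuous_on UNIV f"
  shows "norm (f z) \<le> max_modulus (norm z) f"
proof -
  \<comment> \<open>Boundedness is first obtained on the closed interval, which is compact, and then
    restricted to the half-open range of angles over which the supremum is taken.\<close>
  have "continuous_on {0..2 * pi} (\<lambda>\<theta>. norm (f (of_real (norm z) * cis \<theta>)))"
    by (intro continuous_intros continuous_on_compose2[OF assms]) auto
  then have "bdd_above ((\<lambda>\<theta>. norm (f (of_real (norm z) * cis \<theta>))) ` {0..2 * pi})"
    by (intro bounded_imp_bdd_above compact_imp_bounded compact_continuous_image) auto
  then have "bdd_above ((\<lambda>\<theta>. norm (f (of_real (norm z) * cis \<theta>))) ` {0..<2 * pi})"
    by (rule bdd_above_mono) auto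
  moreover have "z = of_real (norm z) * cis (Arg2pi z)"
    by (metis Arg2pi_eq cis_conv_exp)
  moreover have "Arg2pi z \<in> {0..<2 * pi}"
    using Arg2pi by auto
  ultimately show ?thesis
    unfolding max_modulus_def by (metis (no_types, lifting) cSUP_upper)
qed

lemma max_modulus_le:
  assumes "0 \<le> r" and "\<And>z. norm z = r \<Longrightarrow> norm (f z) \<le> B"
  shows "max_modulus r f \<le> B"
  unfolding max_modulus_def
  by (rule cSUP_least) (use assms in \<open>auto simp: norm_mult\<close>)

text \<open>This is Cauchy's formula for higher derivatives with the contour integral unfolded:
  \<open>circlepath 0 r\<close> has derivative \<open>2 * pi * \<i>\<close> times itself, so one
  power of the denominator and the factor \<open>2 * pi * \<i>\<close> cancel.\<close>

lemma circle_mean_coeff: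
  assumes "h holomorphic_on UNIV" "0 < r"
  shows "((\<lambda>t. h (circlepath 0 r t) / circlepath 0 r t ^ n)
           has_integral ((deriv ^^ n) h 0 / fact n)) {0..1}"
proof -
  have "((\<lambda>u. h u / (u - 0) ^ Suc n) has_contour_integral
      (2 * pi * \<i>) / fact n * (deriv ^^ n) h 0) (circlepath 0 r)"
    by (rule Cauchy_has_contour_integral_higher_derivative_circlepath)
      (use assms in \<open>auto intro: holomorphic_on_imp_continuous_on holomorphic_on_subset\<close>)
  then have "((\<lambda>t. h (circlepath 0 r t) / circlepath 0 r t ^ Suc n * (2 * pi * \<i> * circlepath 0 r t))
      has_integral (2 * pi * \<i>) / fact n * (deriv ^^ n) h 0) {0..1}"
    unfolding has_contour_integral vector_derivative_circlepath
    by (simp add: circlepath mult_ac)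
  then have "((\<lambda>t. h (circlepath 0 r t) / circlepath 0 r t ^ Suc n * (2 * pi * \<i> * circlepath 0 r t)
      / (2 * pi * \<i>)) has_integral (2 * pi * \<i>) / fact n * (deriv ^^ n) h 0 / (2 * pi * \<i>)) {0..1}"
    by (rule has_integral_divide)
  moreover have "circlepath 0 r t \<noteq> 0" for t
    using assms by (simp add: circlepath)
  ultimately show ?thesis
    by (simp add: field_simps)
qed

text \<open>The circle mean of \<open>(h + cnj g) / z ^ n\<close> equals \<open>a n\<close>, while
  the integrand is at most \<open>B / r ^ n\<close> in norm. The hypotheses give a series for
  \<open>h\<close> only, so that the lemma can be reused with \<open>h\<close> and \<open>g\<close>
  exchanged.\<close>

lemma harmonic_coeff_bound:
  assumes h: "h holomorphic_on UNIV" and g: "g holomorphic_on UNIV"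
    and sums: "\<And>z. (\<lambda>n. a n * z ^ n) sums h z"
    and bound: "\<And>z. norm z = r \<Longrightarrow> norm (h z + cnj (g z)) \<le> B"
    and "0 < r" "0 < n"
  shows "norm (a n) * r ^ n \<le> B"
proof -
  define c where "c = circlepath 0 r"
  have norm_c: "norm (c t) = r" for t
    using \<open>0 < r\<close> by (simp add: c_def circlepath norm_mult)
  have c_nz: "c t \<noteq> 0" for t
    using norm_c[of t] \<open>0 < r\<close> by auto
  have "h has_fps_expansion Abs_fps a"
    by (rule has_fps_expansionI) (simp add: sums)
  then have a: "(deriv ^^ n) h 0 / fact n = a n"
    by (metis fps_nth_fps_expansion fps_nth_Abs_fps)
  have int_h: "((\<lambda>t. h (c t) / c t ^ n) has_integral a n) {0..1}"
    using circle_mean_coeff[OF h \<open>0 < r\<close>, of n] by (simp add: a c_def)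
  have "(\<lambda>z. z ^ n * g z) holomorphic_on UNIV"
    by (intro holomorphic_intros g)
  \<comment> \<open>The case of order 0 is the mean value property; the value of
    \<open>z ^ n * g z\<close> at the origin vanishes because \<open>n\<close> is positive.\<close>
  from circle_mean_coeff[OF this \<open>0 < r\<close>, of 0]
  have "((\<lambda>t. c t ^ n * g (c t)) has_integral 0) {0..1}"
    using \<open>0 < n\<close> by (simp add: c_def zero_power)
  then have "((\<lambda>t. cnj (c t ^ n * g (c t))) has_integral 0) {0..1}"
    using has_integral_cnj[of "\<lambda>t. c t ^ n * g (c t)" 0] by (simp add: o_def)
  \<comment> \<open>On the circle \<open>cnj (c t) ^ n / r ^ (2 * n)\<close> is
    \<open>1 / c t ^ n\<close>, so conjugating the vanishing mean gives the mean of
    \<open>cnj g / z ^ n\<close>.\<close>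
  then have "((\<lambda>t. cnj (c t ^ n * g (c t)) / of_real (r ^ (2 * n))) has_integral 0 / of_real (r ^ (2 * n))) {0..1}"
    by (rule has_integral_divide)
  moreover have "cnj (c t ^ n * g (c t)) / of_real (r ^ (2 * n)) = cnj (g (c t)) / c t ^ n" for t
  proof -
    have "c t ^ n * cnj (c t) ^ n = of_real (r ^ (2 * n))"
      using complex_norm_square[of "c t"]
      by (simp add: norm_c power_mult flip: power_mult_distrib)
    then show ?thesis
      using c_nz[of t] \<open>0 < r\<close> by (simp add: field_simps)
  qed
  ultimately have int_g: "((\<lambda>t. cnj (g (c t)) / c t ^ n) has_integral 0) {0..1}"
    by simp
  have "((\<lambda>t. (h (c t) + cnj (g (c t))) / c t ^ n) has_integral a n) {0..1}"
    using has_integral_add[OF int_h int_g] by (simp add: add_divide_distrib)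
  moreover have "norm ((h (c t) + cnj (g (c t))) / c t ^ n) \<le> B / r ^ n" for t
    using bound[OF norm_c] \<open>0 < r\<close>
    by (simp add: norm_divide norm_power norm_c divide_right_mono)
  moreover have "0 \<le> B / r ^ n"
    using bound[OF norm_c] \<open>0 < r\<close> by (meson divide_nonneg_pos norm_ge_zero order_trans zero_less_power)
  ultimately have "norm (a n) \<le> B / r ^ n * measure lborel (cbox 0 (1::real))"
    by (intro has_integral_bound) auto
  then show ?thesis
    using \<open>0 < r\<close> by (simp add: field_simps)
qed

section \<open>Exponential growth bounds from coefficient bounds\<close>

lemma powr_mult_power_le_exp:
  fixes L r \<rho> :: real
  assumes "0 < L" "0 < r" "0 < \<rho>" "0 < n"
  shows "(L / n) powr (n / \<rho>) * r ^ n \<le> exp (L * r powr \<rho> / (exp 1 * \<rho>))"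
proof -
  \<comment> \<open>With this \<open>y\<close> the left-hand side becomes
    \<open>y powr (n / \<rho>)\<close>, and the claim reduces to
    \<open>ln y \<le> y / exp 1\<close>.\<close>
  define y where "y = L * r powr \<rho> / n"
  have "0 < y"
    using assms by (simp add: y_def)
  \<comment> \<open>The tangent to the logarithm is taken at \<open>y = exp 1\<close>, where its
    constant term vanishes; this produces the factor 1/e in the type formula.\<close>
  have "ln (y / exp 1) \<le> y / exp 1 - 1"
    using \<open>0 < y\<close> by (intro ln_le_minus_one) auto
  then have ln_y: "ln y \<le> y / exp 1"
    using \<open>0 < y\<close> by (simp add: ln_div)
  have "r ^ n = (r powr \<rho>) powr (n / \<rho>)"
    using assms by (simp add: powr_powr powr_realpow)
  then have "(L / n) powr (n / \<rho>) * r ^ n = y powr (n / \<rho>)"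
    using assms by (simp add: y_def flip: powr_mult)
  also have "\<dots> = exp (n / \<rho> * ln y)"
    using \<open>0 < y\<close> by (simp add: powr_def)
  also have "\<dots> \<le> exp (n / \<rho> * (y / exp 1))"
    unfolding exp_le_cancel_iff using ln_y assms by (intro mult_left_mono) auto
  also have "n / \<rho> * (y / exp 1) = L * r powr \<rho> / (exp 1 * \<rho>)"
    using assms by (simp add: y_def field_simps)
  finally show ?thesis .
qed

text \<open>The quotient of \<open>c n\<close> by the weight
  \<open>(L / n) powr (n / \<rho>)\<close> is eventually below a geometric sequence, and each weight
  times \<open>r ^ n\<close> obeys an exponential bound independent of \<open>n\<close>, which can
  be pulled out of the sum. Indices start at \<open>Suc n\<close> because the weight at 0 evaluates
  to 0.\<close>

lemma power_series_growth_bound: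
  fixes c :: "nat \<Rightarrow> real"
  assumes c: "\<And>n. 0 \<le> c n" and "0 < \<rho>"
    and limsup: "limsup (\<lambda>n. ereal (n * c n powr (\<rho> / n))) < ereal L"
  obtains K where "0 < K"
    and "\<And>r. 0 < r \<Longrightarrow> summable (\<lambda>n. c (Suc n) * r ^ Suc n)"
    and "\<And>r. 0 < r \<Longrightarrow> (\<Sum>n. c (Suc n) * r ^ Suc n) \<le> K * exp (L * r powr \<rho> / (exp 1 * \<rho>))"
proof -
  \<comment> \<open>The gap between \<open>L'\<close> and \<open>L\<close> makes the ratio
    \<open>q\<close> below smaller than 1.\<close>
  obtain L' where L': "limsup (\<lambda>n. ereal (n * c n powr (\<rho> / n))) < ereal L'" "L' < L"
    using ereal_dense2[OF limsup] by auto
  have ev: "\<forall>\<^sub>F n in sequentially. n * c n powr (\<rho> / n) < L'"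
    using Limsup_lessD[OF L'(1)] by simp
  \<comment> \<open>A single nonnegative term below \<open>L'\<close> already forces
    \<open>L'\<close> to be positive.\<close>
  then obtain m where "m * c m powr (\<rho> / m) < L'"
    by (auto simp: eventually_sequentially)
  moreover have "0 \<le> m * c m powr (\<rho> / m)"
    by simp
  ultimately have "0 < L'"
    by linarith
  with \<open>L' < L\<close> have "0 < L" by simp
  define d where "d n = c n / (L / n) powr (n / \<rho>)" for n
  define q where "q = (L' / L) powr (1 / \<rho>)"
  have d_nonneg: "0 \<le> d n" for n
    by (simp add: d_def c)
  have "q < 1"
    using \<open>0 < L'\<close> \<open>L' < L\<close> \<open>0 < \<rho>\<close> powr_less_mono2[of "1 / \<rho>" "L' / L" 1] by (simp add: q_def)
  moreover have "0 \<le> q"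
    by (simp add: q_def)
  moreover have "\<forall>\<^sub>F n in sequentially. norm (d n) \<le> q ^ n"
    using ev eventually_gt_at_top[of 0]
  proof eventually_elim
    case (elim n)
    have "c n = (c n powr (\<rho> / n)) powr (n / \<rho>)"
      using elim \<open>0 < \<rho>\<close> c by (simp add: powr_powr)
    also have "\<dots> \<le> (L' / n) powr (n / \<rho>)"
      using elim \<open>0 < \<rho>\<close> by (intro powr_mono2) (auto simp: field_simps)
    also have "\<dots> = (L' / L * (L / n)) powr (n / \<rho>)"
      using \<open>0 < L\<close> by simp
    also have "\<dots> = (L' / L) powr (n / \<rho>) * (L / n) powr (n / \<rho>)"
      by (rule powr_mult)
    also have "(L' / L) powr (n / \<rho>) = q ^ n"
      using \<open>0 < L\<close> \<open>0 < L'\<close> by (simp add: q_def powr_powr flip: powr_realpow)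
    finally show ?case
      using elim \<open>0 < L\<close> c[of n] by (simp add: d_def divide_le_eq)
  qed
  ultimately have "summable d"
    by (intro summable_comparison_test_ev[OF _ summable_geometric]) auto
  then have d: "summable (\<lambda>n. d (Suc n))"
    by (simp add: summable_Suc_iff)
  have term_le: "c (Suc n) * r ^ Suc n \<le> d (Suc n) * exp (L * r powr \<rho> / (exp 1 * \<rho>))"
    if "0 < r" for n r
  proof -
    have "c (Suc n) * r ^ Suc n = d (Suc n) * ((L / Suc n) powr (Suc n / \<rho>) * r ^ Suc n)"
      using \<open>0 < L\<close> by (simp add: d_def)
    also have "\<dots> \<le> d (Suc n) * exp (L * r powr \<rho> / (exp 1 * \<rho>))"
      by (intro mult_left_mono powr_mult_power_le_exp d_nonneg) (use \<open>0 < L\<close> that \<open>0 < \<rho>\<close> in auto)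
    finally show ?thesis .
  qed
  have summable: "summable (\<lambda>n. c (Suc n) * r ^ Suc n)" if "0 < r" for r
    by (rule summable_comparison_test'[OF summable_mult2[OF d]])
      (use term_le[OF that] c that in \<open>simp add: abs_mult\<close>)
  \<comment> \<open>The added 1 keeps the constant positive even if every \<open>d (Suc n)\<close>
    vanishes.\<close>
  have "(\<Sum>n. c (Suc n) * r ^ Suc n) \<le> ((\<Sum>n. d (Suc n)) + 1) * exp (L * r powr \<rho> / (exp 1 * \<rho>))"
    if "0 < r" for r
  proof -
    have "(\<Sum>n. c (Suc n) * r ^ Suc n) \<le> (\<Sum>n. d (Suc n) * exp (L * r powr \<rho> / (exp 1 * \<rho>)))"
      by (intro suminf_le term_le summable summable_mult2 d that)
    also have "\<dots> = (\<Sum>n. d (Suc n)) * exp (L * r powr \<rho> / (exp 1 * \<rho>))"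
      by (rule suminf_mult2[OF d, symmetric])
    finally show ?thesis
      by (simp add: distrib_right add_increasing2)
  qed
  moreover have "0 < (\<Sum>n. d (Suc n)) + 1"
    using suminf_nonneg[OF d] d_nonneg by (simp add: add_nonneg_pos)
  ultimately show ?thesis
    using summable that by blast
qed

section \<open>Coefficient bounds from exponential growth\<close>

lemma coeff_limsup_le:
  fixes c :: "nat \<Rightarrow> real" and M :: "real \<Rightarrow> real"
  assumes c: "\<And>n. 0 \<le> c n" and "0 < \<rho>" "0 < T"
    and le: "\<And>n r. 0 < n \<Longrightarrow> 0 < r \<Longrightarrow> c n * r ^ n \<le> 2 * M r"
    and M: "\<forall>\<^sub>F r in at_top. M r \<le> exp (T * r powr \<rho>)"
  shows "limsup (\<lambda>n. ereal (n * c n powr (\<rho> / n))) \<le> ereal (exp 1 * \<rho> * T)"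
proof -
  \<comment> \<open>\<open>R n\<close> is the radius minimizing
    \<open>exp (T * r powr \<rho>) / r ^ n\<close>. It tends to infinity, so the eventual bound on
    \<open>M\<close> applies along it.\<close>
  define R where "R n = (real n / (\<rho> * T)) powr (1 / \<rho>)" for n :: nat
  have "filterlim R at_top sequentially"
    unfolding R_def using assms by real_asymp
  then have "\<forall>\<^sub>F n in sequentially. M (R n) \<le> exp (T * R n powr \<rho>)"
    by (rule eventually_compose_filterlim[OF M])
  then have "\<forall>\<^sub>F n in sequentially. n * c n powr (\<rho> / n) \<le> 2 powr (\<rho> / n) * (exp 1 * \<rho> * T)"
    using eventually_gt_at_top[of 0]
  proof eventually_elim
    case (elim n)
    have "0 < R n"
      using elim assms by (simp add: R_def)
    have "R n powr \<rho> = n / (\<rho> * T)"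
      using elim assms by (simp add: R_def powr_powr)
    then have "exp (T * R n powr \<rho>) = exp (n / \<rho>)"
      using assms by simp
    moreover have Rn: "R n ^ n = (n / (\<rho> * T)) powr (n / \<rho>)"
      using \<open>0 < R n\<close> by (simp add: R_def powr_powr flip: powr_realpow)
    ultimately have "c n * (n / (\<rho> * T)) powr (n / \<rho>) \<le> 2 * exp (n / \<rho>)"
      using le[of n "R n"] elim \<open>0 < R n\<close> by simp
    then have "(c n * (n / (\<rho> * T)) powr (n / \<rho>)) powr (\<rho> / n) \<le> (2 * exp (n / \<rho>)) powr (\<rho> / n)"
      using c assms by (intro powr_mono2) auto
    moreover have "(c n * (n / (\<rho> * T)) powr (n / \<rho>)) powr (\<rho> / n) = c n powr (\<rho> / n) * (n / (\<rho> * T))"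
      using elim assms c by (simp add: powr_mult powr_powr)
    moreover have "(2 * exp (n / \<rho>)) powr (\<rho> / n) = 2 powr (\<rho> / n) * exp 1"
      using elim assms by (simp add: powr_mult exp_powr_real)
    ultimately have "c n powr (\<rho> / n) * (n / (\<rho> * T)) \<le> 2 powr (\<rho> / n) * exp 1"
      by simp
    then show ?case
      using \<open>0 < \<rho>\<close> \<open>0 < T\<close> by (simp add: field_simps)
  qed
  then have "limsup (\<lambda>n. ereal (n * c n powr (\<rho> / n)))
      \<le> limsup (\<lambda>n. ereal (2 powr (\<rho> / n) * (exp 1 * \<rho> * T)))"
    by (intro Limsup_mono) simp
  also have "(\<lambda>n::nat. 2 powr (\<rho> / n) * (exp 1 * \<rho> * T)) \<longlonglongrightarrow> exp 1 * \<rho> * T"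
    by real_asymp
  then have "limsup (\<lambda>n. ereal (2 powr (\<rho> / n) * (exp 1 * \<rho> * T))) = ereal (exp 1 * \<rho> * T)"
    by (intro lim_imp_Limsup) auto
  finally show ?thesis .
qed

text \<open>Taking logarithms turns the factor \<open>K\<close> into the summand
  \<open>ln K / r powr \<rho>\<close>, which tends to 0, so constant factors do not affect the
  type.\<close>

lemma Limsup_log_growth_le:
  fixes M :: "real \<Rightarrow> real"
  assumes "0 < \<rho>" "0 < K"
    and pos: "\<forall>\<^sub>F r in at_top. 0 < M r"
    and le: "\<forall>\<^sub>F r in at_top. M r \<le> K * exp (s * r powr \<rho>)"
  shows "Limsup at_top (\<lambda>r. ereal (ln (M r) / r powr \<rho>)) \<le> ereal s"
proof -
  have "\<forall>\<^sub>F r in at_top. ln (M r) / r powr \<rho> \<le> ln K / r powr \<rho> + s"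
    using pos le eventually_gt_at_top[of 0]
  proof eventually_elim
    case (elim r)
    have "ln (M r) \<le> ln (K * exp (s * r powr \<rho>))"
      using elim by (intro ln_mono) auto
    also have "\<dots> = ln K + s * r powr \<rho>"
      using \<open>0 < K\<close> by (simp add: ln_mult)
    finally show ?case
      using elim by (simp add: field_simps)
  qed
  then have "Limsup at_top (\<lambda>r. ereal (ln (M r) / r powr \<rho>))
      \<le> Limsup at_top (\<lambda>r. ereal (ln K / r powr \<rho> + s))"
    by (intro Limsup_mono) simp
  also have "((\<lambda>r. ln K / r powr \<rho> + s) \<longlongrightarrow> s) at_top"
    using \<open>0 < \<rho>\<close> by real_asymp
  then have "Limsup at_top (\<lambda>r. ereal (ln K / r powr \<rho> + s)) = ereal s"
    by (intro lim_imp_Limsup) auto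
  finally show ?thesis .
qed

section \<open>The two inequalities between the type and the coefficient limsup\<close>

theorem theorem2:
  fixes f h g :: "complex \<Rightarrow> complex" and a b :: "nat \<Rightarrow> complex" and \<rho> :: real
  assumes "harmonic_entire f"
    and "h holomorphic_on UNIV" and "g holomorphic_on UNIV" and "g 0 = 0"
    and "\<And>z. f z = h z + cnj (g z)"
    and "\<And>z. (\<lambda>n. a n * z ^ n) sums h z"
    and "\<And>z. (\<lambda>n. b (Suc n) * z ^ Suc n) sums g z"
    and "growth_order f = ereal \<rho>" and "0 < \<rho>"
    and "growth_type f < \<infinity>"
  shows "growth_type f =
    ereal (1 / (exp 1 * \<rho>)) *
      limsup (\<lambda>n. ereal (real n * (norm (a n) + norm (b n)) powr (\<rho> / real n)))"
proof -
  define c where "c n = norm (a n) + norm (b n)" for n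
  define M where "M r = max_modulus r f" for r
  define \<Lambda> where "\<Lambda> = limsup (\<lambda>n. ereal (real n * c n powr (\<rho> / real n)))"
  note hol = assms(2,3) and f_eq = assms(5) and sums_h = assms(6) and sums_g = assms(7)
  note \<rho> = assms(9)
  have c_nonneg: "0 \<le> c n" for n
    by (simp add: c_def)
  have type_eq: "growth_type f = Limsup at_top (\<lambda>r. ereal (ln (M r) / r powr \<rho>))"
    by (simp add: growth_type_def assms(8) M_def)
  have "continuous_on UNIV f"
    unfolding f_eq[abs_def]
    by (intro continuous_intros holomorphic_on_imp_continuous_on hol)
  then have f_le: "norm (f z) \<le> M (norm z)" for z
    unfolding M_def by (rule norm_le_max_modulus)

  have coeff_le: "c n * r ^ n \<le> 2 * M r" if "0 < n" "0 < r" for n r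
  proof -
    \<comment> \<open>The series of \<open>g\<close> starts at index 1 and leaves \<open>b 0\<close>
      arbitrary, so the coefficient at 0 is set to 0 before a full power series is formed.\<close>
    define b' where "b' m = (if m = 0 then 0 else b m)" for m
    have "(\<lambda>m. b' m * z ^ m) sums g z" for z
      using sums_g[of z] sums_Suc_iff[of "\<lambda>m. b' m * z ^ m" "g z"] by (simp add: b'_def)
    \<comment> \<open>Conjugating \<open>f\<close> exchanges the roles of \<open>h\<close> and
      \<open>g\<close> without changing the modulus.\<close>
    moreover have "norm (g z + cnj (h z)) \<le> M r" if "norm z = r" for z
    proof -
      have "g z + cnj (h z) = cnj (f z)"
        by (simp add: f_eq)
      then show ?thesis
        using f_le[of z] that by (metis complex_mod_cnj)
    qed
    ultimately have "norm (b' n) * r ^ n \<le> M r"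
      using hol that by (intro harmonic_coeff_bound[of g h b'])
    moreover have "norm (a n) * r ^ n \<le> M r"
      using f_le f_eq by (intro harmonic_coeff_bound[OF hol sums_h _ that(2,1)]) metis
    ultimately show ?thesis
      using that by (simp add: c_def b'_def distrib_right)
  qed

  \<comment> \<open>Constants have order 0, whereas \<open>\<rho>\<close> is positive.\<close>
  have "\<not> f constant_on UNIV"
    using assms(8,9) by (auto simp: growth_order_def)
  have "\<exists>n>0. c n \<noteq> 0"
  proof (rule ccontr)
    assume "\<not> ?thesis"
    then have c_zero: "c n = 0" if "0 < n" for n
      using that by blast
    have zero: "a n = 0" "b n = 0" if "0 < n" for n
      using c_zero[OF that] by (simp_all add: c_def add_nonneg_eq_0_iff)
    have "h z = a 0" for z
    proof -
      have "(\<lambda>n. a n * z ^ n) sums (\<Sum>n\<in>{0}. a n * z ^ n)"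
        by (rule sums_finite) (auto simp: zero)
      then show ?thesis
        using sums_h[of z] by (simp add: sums_unique2)
    qed
    moreover have "g z = 0" for z
      using sums_g[of z] sums_unique2[OF sums_zero] by (fastforce simp: zero)
    ultimately have "f constant_on UNIV"
      by (auto simp: constant_on_def f_eq)
    with \<open>\<not> f constant_on UNIV\<close> show False ..
  qed
  then obtain k where k: "0 < k" "0 < c k"
    using c_nonneg by (metis order_le_less)
  \<comment> \<open>One nonzero coefficient of positive index forces \<open>M\<close> to infinity;
    eventually \<open>ln (M r)\<close> is then nonnegative.\<close>
  have "filterlim (\<lambda>r. c k * r ^ k / 2) at_top at_top"
    using k by real_asymp
  then have "\<forall>\<^sub>F r in at_top. 1 \<le> c k * r ^ k / 2"
    unfolding filterlim_at_top by blast
  then have M_ge_1: "\<forall>\<^sub>F r in at_top. 1 \<le> M r"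
    using eventually_gt_at_top[of 0]
    by eventually_elim (use coeff_le[of k] k in fastforce)

  have upper: "growth_type f \<le> ereal (1 / (exp 1 * \<rho>)) * ereal L" if L: "\<Lambda> < ereal L" for L
  proof -
    obtain K where "0 < K"
      and K_sum: "\<And>r. 0 < r \<Longrightarrow> summable (\<lambda>n. c (Suc n) * r ^ Suc n)"
      and K_le: "\<And>r. 0 < r \<Longrightarrow> (\<Sum>n. c (Suc n) * r ^ Suc n) \<le> K * exp (L * r powr \<rho> / (exp 1 * \<rho>))"
      using power_series_growth_bound[OF c_nonneg \<rho> L[unfolded \<Lambda>_def]] by blast
    have "0 \<le> \<Lambda>"
      unfolding \<Lambda>_def by (intro le_Limsup) auto
    then have "0 < L"
      using L by (metis ereal_less(2) order_le_less_trans)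
    have "M r \<le> (norm (a 0) + K) * exp (L / (exp 1 * \<rho>) * r powr \<rho>)" if "0 < r" for r
      unfolding M_def
    proof (rule max_modulus_le)
      fix z :: complex assume z: "norm z = r"
      have sums_h': "(\<lambda>n. a (Suc n) * z ^ Suc n) sums (h z - a 0)"
        using sums_h[of z] by (subst sums_Suc_iff) simp
      have "(\<lambda>n. a (Suc n) * z ^ Suc n + cnj (b (Suc n) * z ^ Suc n)) sums (h z - a 0 + cnj (g z))"
        using sums_g[of z] by (intro sums_add sums_h') (simp only: sums_cnj)
      moreover have "norm (a (Suc n) * z ^ Suc n + cnj (b (Suc n) * z ^ Suc n)) \<le> c (Suc n) * r ^ Suc n" for n
        by (rule norm_triangle_le)
          (simp add: c_def norm_mult norm_power z distrib_right del: complex_cnj_mult)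
      ultimately have "norm (h z - a 0 + cnj (g z)) \<le> (\<Sum>n. c (Suc n) * r ^ Suc n)"
        using K_sum[OF \<open>0 < r\<close>] by (metis (no_types, lifting) norm_suminf_le sums_unique)
      also have "\<dots> \<le> K * exp (L / (exp 1 * \<rho>) * r powr \<rho>)"
        using K_le[OF \<open>0 < r\<close>] by simp
      finally have "norm (h z - a 0 + cnj (g z)) \<le> K * exp (L / (exp 1 * \<rho>) * r powr \<rho>)" .
      \<comment> \<open>The constant term is absorbed into the exponential, which is at least 1
        because \<open>L\<close> is positive.\<close>
      moreover have "norm (a 0) \<le> norm (a 0) * exp (L / (exp 1 * \<rho>) * r powr \<rho>)"
        using \<open>0 < L\<close> \<rho> by (simp add: mult_le_cancel_left1)
      moreover have "norm (f z) \<le> norm (a 0) + norm (h z - a 0 + cnj (g z))"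
        using norm_triangle_ineq[of "a 0" "h z - a 0 + cnj (g z)"] by (simp add: f_eq)
      ultimately show "norm (f z) \<le> (norm (a 0) + K) * exp (L / (exp 1 * \<rho>) * r powr \<rho>)"
        by (simp add: distrib_right)
    qed (use that in simp)
    then have "\<forall>\<^sub>F r in at_top. M r \<le> (norm (a 0) + K) * exp (L / (exp 1 * \<rho>) * r powr \<rho>)"
      using eventually_gt_at_top[of 0] by (rule eventually_mono[rotated])
    moreover have "\<forall>\<^sub>F r in at_top. 0 < M r"
      using M_ge_1 by eventually_elim simp
    ultimately have "growth_type f \<le> ereal (L / (exp 1 * \<rho>))"
      unfolding type_eq using \<open>0 < K\<close> \<rho>
      by (intro Limsup_log_growth_le[where K = "norm (a 0) + K"]) (auto intro: add_nonneg_pos)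
    then show ?thesis
      by simp
  qed

  have lower: "\<Lambda> \<le> ereal (exp 1 * \<rho>) * ereal T" if "growth_type f < ereal T" for T
  proof -
    \<comment> \<open>This makes \<open>T\<close> positive, as the choice of radius in
      \<open>coeff_limsup_le\<close> requires.\<close>
    have "0 \<le> growth_type f"
      unfolding type_eq
      by (intro le_Limsup) (use M_ge_1 in \<open>auto elim!: eventually_mono\<close>)
    then have "0 < T"
      using that by (metis ereal_less(2) order_le_less_trans)
    have "\<forall>\<^sub>F r in at_top. ln (M r) / r powr \<rho> < T"
      using Limsup_lessD[OF that[unfolded type_eq]] by simp
    then have "\<forall>\<^sub>F r in at_top. M r \<le> exp (T * r powr \<rho>)"
      using M_ge_1 eventually_gt_at_top[of 0]
    proof eventually_elim
      case (elim r)
      then have "ln (M r) \<le> T * r powr \<rho>"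
        by (simp add: field_simps)
      then show ?case
        using elim by (metis exp_le_cancel_iff exp_ln less_le_trans zero_less_one)
    qed
    then show ?thesis
      unfolding \<Lambda>_def using coeff_limsup_le[OF c_nonneg \<rho> \<open>0 < T\<close> coeff_le] by simp
  qed

  \<comment> \<open>Cancelling the reciprocal real factors is valid for every extended real
    \<open>x\<close>, so infinite values need no separate case.\<close>
  have inv: "ereal (1 / (exp 1 * \<rho>)) * (ereal (exp 1 * \<rho>) * x) = x"
    "ereal (exp 1 * \<rho>) * (ereal (1 / (exp 1 * \<rho>)) * x) = x" for x
    using \<rho> by (simp_all flip: mult.assoc)
  have "ereal (exp 1 * \<rho>) * growth_type f \<le> \<Lambda>"
  \<comment> \<open>\<open>upper\<close> speaks of real bounds only; a real number strictly between
    \<open>\<Lambda>\<close> and \<open>x\<close> carries it over to extended reals.\<close>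
  proof (rule dense_ge)
    fix x assume "\<Lambda> < x"
    have "ereal (exp 1 * \<rho>) * growth_type f \<le> ereal L" if "\<Lambda> < ereal L" for L
      using ereal_mult_left_mono[OF upper[OF that], of "ereal (exp 1 * \<rho>)"] \<rho>
      by (simp only: inv) simp
    then show "ereal (exp 1 * \<rho>) * growth_type f \<le> x"
      using ereal_dense2[OF \<open>\<Lambda> < x\<close>] by (meson less_imp_le order_trans)
  qed
  moreover have "ereal (1 / (exp 1 * \<rho>)) * \<Lambda> \<le> growth_type f"
  proof (rule dense_ge)
    fix x assume "growth_type f < x"
    have "ereal (1 / (exp 1 * \<rho>)) * \<Lambda> \<le> ereal T" if "growth_type f < ereal T" for T
      using ereal_mult_left_mono[OF lower[OF that], of "ereal (1 / (exp 1 * \<rho>))"] \<rho>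
      by (simp only: inv) simp
    then show "ereal (1 / (exp 1 * \<rho>)) * \<Lambda> \<le> x"
      using ereal_dense2[OF \<open>growth_type f < x\<close>] by (meson less_imp_le order_trans)
  qed
  ultimately have "growth_type f = ereal (1 / (exp 1 * \<rho>)) * \<Lambda>"
    using ereal_mult_left_mono[of "ereal (exp 1 * \<rho>) * growth_type f" \<Lambda> "ereal (1 / (exp 1 * \<rho>))"] \<rho>
    by (simp only: inv) (simp add: antisym)
  then show ?thesis
    by (simp add: \<Lambda>_def c_def)
qed

end
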